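(* Let $\mathcal{A}$ be a $C^*$-algebra with unit $e$, let $\Phi\colon\mathcal{A}\to\mathcal{A}$ be a unital completely positive linear map, and let $a\in\mathcal{A}$. The following assertions are equivalent: (i) $a,a^*a,aa^*\in\mathcal{A}^\Phi$, that is, $\Phi(a)=a$, $\Phi(a^*a)=a^*a$, and $\Phi(aa^* )=aa^*$. (ii) $a\in\mathcal{A}^\Phi\cap\mathcal{M}_\Phi$, that is, $\Phi(ax)=a\Phi(x)$ and $\Phi(xa)=\Phi(x)a$ for all $x\in\mathcal{A}$. (iii) $C^*(e,a)\subseteq\mathcal{A}^\Phi$, that is, $\Phi(b)=b$ for all $b\in C^*(e,a)$.
   Context: $C^*(e,a)$ denotes the $C^*$-subalgebra of $\mathcal{A}$ generated by $e$ and $a$. $\mathcal{A}^\Phi=\{x\in\mathcal{A}\mid\Phi(x)=x\}$ is the set of fixed points of $\Phi$, and $\mathcal{M}_\Phi=\{x\in\mathcal{A}\mid\Phi(x^*x)=\Phi(x)^*\Phi(x)\text{ and }\Phi(xx^* )=\Phi(x)\Phi(x^* )\}$ is the multiplicative domain of $\Phi$. *)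

theory Defs
  imports Complex_Main "HOL.Hull" "Jordan_Normal_Form.Matrix"
begin

text \<open>The real scalar multiplication and the norm come from the library class, whose
  real structure is tied to the complex one by \<open>scaleR_scaleC\<close>.\<close>

class cstar_algebra = real_normed_algebra + complete_space +
  fixes scaleC :: "complex \<Rightarrow> 'a \<Rightarrow> 'a"
    and star :: "'a \<Rightarrow> 'a"
  assumes scaleC_add_right: "scaleC c (x + y) = scaleC c x + scaleC c y"
    and scaleC_add_left: "scaleC (c + d) x = scaleC c x + scaleC d x"
    and scaleC_scaleC: "scaleC c (scaleC d x) = scaleC (c * d) x"
    and scaleC_one: "scaleC 1 x = x"
    and scaleR_scaleC: "scaleR r x = scaleC (complex_of_real r) x"
    and mult_scaleC_left: "scaleC c x * y = scaleC c (x * y)"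
    and mult_scaleC_right: "x * scaleC c y = scaleC c (x * y)"
    and norm_scaleC: "norm (scaleC c x) = cmod c * norm x"
    and star_star: "star (star x) = x"
    and star_add: "star (x + y) = star x + star y"
    and star_scaleC: "star (scaleC c x) = scaleC (cnj c) (star x)"
    and star_mult: "star (x * y) = star y * star x"
    and cstar_identity: "norm (star x * x) = (norm x)\<^sup>2"

text \<open>The unit is not required to differ from \<open>0\<close>, so the zero algebra is included.\<close>

class unital_cstar_algebra = cstar_algebra + monoid_mult

definition complex_linear ::
    "('a::cstar_algebra \<Rightarrow> 'b::cstar_algebra) \<Rightarrow> bool" where
  "complex_linear f \<longleftrightarrow>
     (\<forall>x y. f (x + y) = f x + f y) \<and> (\<forall>c x. f (scaleC c x) = scaleC c (f x))"

definition star_mat :: "'a::cstar_algebra mat \<Rightarrow> 'a mat" where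
  "star_mat B = map_mat star (transpose_mat B)"

text \<open>A positive element of a \<open>C\<^sup>*\<close>-algebra is one of the form \<open>b\<^sup>* b\<close>; this is that notion in the
  \<open>C\<^sup>*\<close>-algebra \<open>M\<^sub>n(A)\<close> of \<open>n \<times> n\<close> matrices over \<open>A\<close>.\<close>

definition positive_mat :: "nat \<Rightarrow> 'a::cstar_algebra mat \<Rightarrow> bool" where
  "positive_mat n X \<longleftrightarrow> (\<exists>B \<in> carrier_mat n n. X = star_mat B * B)"

definition completely_positive ::
    "('a::cstar_algebra \<Rightarrow> 'b::cstar_algebra) \<Rightarrow> bool" where
  "completely_positive f \<longleftrightarrow>
     (\<forall>n X. positive_mat n X \<longrightarrow> positive_mat n (map_mat f X))"

definition fixed_points :: "('a \<Rightarrow> 'a) \<Rightarrow> 'a set" where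
  "fixed_points f = {x. f x = x}"

definition multiplicative_domain ::
    "('a::cstar_algebra \<Rightarrow> 'b::cstar_algebra) \<Rightarrow> 'a set" where
  "multiplicative_domain f =
     {x. f (star x * x) = star (f x) * f x \<and> f (x * star x) = f x * f (star x)}"

definition cstar_subalgebra :: "'a::cstar_algebra set \<Rightarrow> bool" where
  "cstar_subalgebra S \<longleftrightarrow>
     0 \<in> S \<and> (\<forall>x\<in>S. \<forall>y\<in>S. x + y \<in> S) \<and> (\<forall>c. \<forall>x\<in>S. scaleC c x \<in> S) \<and>
     (\<forall>x\<in>S. \<forall>y\<in>S. x * y \<in> S) \<and> (\<forall>x\<in>S. star x \<in> S) \<and> closed S"

definition generated_cstar :: "'a::cstar_algebra set \<Rightarrow> 'a set" where
  "generated_cstar S = cstar_subalgebra hull S"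

end

theory Submission
  imports Defs "HOL-Analysis.Elementary_Metric_Spaces"
begin

text \<open>
  Complete positivity turns the Gram matrix of \<open>1\<close>, \<open>a\<close>, \<open>x\<^sup>*\<close> into the Gram matrix of three
  columns \<open>u\<close>, \<open>v\<close>, \<open>z\<close> with entries in the algebra: \<open>\<langle>u, u\<rangle> = \<Phi> 1 = 1\<close>, \<open>\<langle>u, v\<rangle> = \<Phi> a\<close>,
  \<open>\<langle>v, v\<rangle> = \<Phi> (a\<^sup>* a)\<close>, \<open>\<langle>z, v\<rangle> = \<Phi> (x a)\<close> (lemma \<open>completely_positive_gram\<close>).  The residual
  \<open>w = v - u \<Phi>(a)\<close> of the projection of \<open>v\<close> along \<open>u\<close> satisfies
  \<open>\<langle>w, w\<rangle> = \<Phi> (a\<^sup>* a) - \<Phi>(a)\<^sup>* \<Phi>(a)\<close> and \<open>\<langle>z, w\<rangle> = \<Phi> (x a) - \<Phi> x \<Phi> a\<close>.  Hence equality in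
  Schwarz's inequality forces \<open>w = 0\<close>, and then \<open>\<Phi> (x a) = \<Phi> x \<Phi> a\<close> for every \<open>x\<close> (lemma
  \<open>cp_mult_right\<close>).  Applied to a fixed point \<open>a\<close> and to \<open>a\<^sup>*\<close>, this says that left
  and right multiplication by \<open>a\<close> commute with \<open>\<Phi>\<close>.  The elements with this property form a
  \<open>C\<^sup>*\<close>-subalgebra, which therefore contains \<open>C\<^sup>*(1, a)\<close>, and each of them is a fixed point, as one
  sees by multiplying with \<open>1\<close>.

  Two steps use more than algebra: \<open>\<langle>w, w\<rangle> = 0\<close> must imply \<open>w = 0\<close>, and \<open>\<Phi>\<close> must be bounded for
  the set of these elements to be closed.  Both follow from the theorem that the elements
  \<open>x\<^sup>* x\<close> lie in a convex cone which meets its negative only in \<open>0\<close>.  The cone is described by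
  norms (\<open>norm_positive\<close>): a self-adjoint \<open>m\<close> belongs to it if \<open>\<parallel>t - m\<parallel> \<le> t\<close> for some
  \<open>t \<ge> 0\<close>.  With this description sums are immediate, and in place of a functional
  calculus only square roots of \<open>1 - u\<close> for \<open>\<parallel>u\<parallel> < 1\<close> are needed, which a contraction
  argument supplies.

  The proof that \<open>x\<^sup>* x\<close> is in the cone rests on two facts.  First, an upper bound for
  \<open>x\<^sup>* x\<close> is an upper bound for \<open>x x\<^sup>*\<close> (\<open>norm_shifted_swap\<close>); since \<open>x\<^sup>* x + x x\<^sup>*\<close> is a sum
  of squares of self-adjoint elements, \<open>x\<^sup>* x \<le> c\<close> thus implies \<open>x\<^sup>* x \<ge> -c\<close>.  Secondly, if
  \<open>x\<^sup>* x = 1 - a\<close> with \<open>a\<close> positive, then \<open>z = x \<surd>(1 + a)\<close> has \<open>z\<^sup>* z = 1 - a\<^sup>2\<close>.  For a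
  contraction \<open>x\<close> one starts with \<open>a = 1 - x\<^sup>* x\<close> and iterates: every \<open>1 - a^(2^n)\<close> with
  \<open>n \<ge> 1\<close> is of the form \<open>z\<^sup>* z\<close> and at most \<open>1\<close>, hence at least \<open>-1\<close>, so
  \<open>\<parallel>a\<parallel>^(2^n) = \<parallel>a^(2^n)\<parallel> \<le> 2\<close> for all \<open>n\<close>.  This is only possible if \<open>\<parallel>a\<parallel> \<le> 1\<close>, that is,
  \<open>\<parallel>1 - x\<^sup>* x\<parallel> \<le> 1\<close>.
\<close>

section \<open>The involution\<close>

lemma norm_star: "norm (star x) = norm (x::'a::cstar_algebra)"
proof -
  have le: "norm y \<le> norm (star y)" for y :: 'a
  proof (cases "norm y = 0")
    case False
    have "norm y * norm y \<le> norm (star y) * norm y"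
      using norm_mult_ineq[of "star y" y] by (simp add: cstar_identity power2_eq_square)
    then show ?thesis using False by simp
  qed simp
  show ?thesis using le[of x] le[of "star x"] by (simp add: star_star)
qed

lemma star_scaleR: "star (r *\<^sub>R x) = r *\<^sub>R star (x::'a::cstar_algebra)"
  by (simp add: scaleR_scaleC star_scaleC)

lemma bounded_linear_star: "bounded_linear (star :: 'a::cstar_algebra \<Rightarrow> 'a)"
  by (rule bounded_linear_intro[where K = 1]) (auto simp: star_add star_scaleR norm_star)

lemmas star_diff = bounded_linear.linear[OF bounded_linear_star, THEN linear_diff]
lemmas star_zero = bounded_linear.linear[OF bounded_linear_star, THEN linear_0]
lemmas star_sum = bounded_linear.linear[OF bounded_linear_star, THEN linear_sum]

lemma scaleC_minus_left: "scaleC (- c) x = - scaleC c (x::'a::cstar_algebra)"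
  using scaleC_scaleC[of "- 1" c x] scaleR_scaleC[of "- 1" "scaleC c x"] by simp

lemma scaleC_diff_right: "scaleC c (x - y) = scaleC c x - scaleC c (y::'a::cstar_algebra)"
  using scaleC_add_right[of c "x - y" y] by simp

lemma scaleC_i_scaleC_i: "scaleC \<i> (scaleC \<i> x) = - (x::'a::cstar_algebra)"
  by (simp add: scaleC_scaleC scaleC_minus_left scaleC_one)

lemma star_one: "star 1 = (1::'a::unital_cstar_algebra)"
  by (metis mult_1_left mult_1_right star_mult star_star)

lemma norm_one_le: "norm (1::'a::unital_cstar_algebra) \<le> 1"
  using cstar_identity[of "1::'a"]
  by (cases "(1::'a) = 0") (simp_all add: star_one power2_eq_square)

lemma norm_scaleR_one_le: "0 \<le> r \<Longrightarrow> norm (r *\<^sub>R (1::'a::unital_cstar_algebra)) \<le> r"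
  using mult_left_mono[OF norm_one_le[where 'a='a], of r] by simp

lemma star_power: "star (x ^ n) = star (x::'a::unital_cstar_algebra) ^ n"
  by (induction n) (auto simp: star_one star_mult power_commutes)

text \<open>For self-adjoint elements the \<open>C\<^sup>*\<close>-identity makes the norm exact on repeated squares, so a
  bound on the powers that grows subexponentially, apart from a factor \<open>M^n\<close>, bounds the norm
  by \<open>M\<close>.  This replaces the spectral radius formula.\<close>

lemma norm_power_self_adjoint:
  fixes h :: "'a::unital_cstar_algebra"
  assumes "star h = h"
  shows "norm (h ^ 2 ^ n) = norm h ^ 2 ^ n"
proof (induction n)
  case (Suc n)
  have "norm (h ^ 2 ^ Suc n) = norm (star (h ^ 2 ^ n) * h ^ 2 ^ n)"
    using assms by (simp add: star_power mult_2 power_add)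
  then show ?case
    by (simp add: cstar_identity Suc power_even_eq)
qed simp

text \<open>Squaring Bernoulli's inequality gives a lower bound for \<open>(1 + d)^(2^n)\<close> that is quadratic in
  the exponent.\<close>

lemma le_one_if_powers_grow_linearly:
  fixes r :: real
  assumes grow: "\<And>n. r ^ 2 ^ n \<le> 1 + C * 2 ^ n" and "0 \<le> C"
  shows "r \<le> 1"
proof (rule ccontr)
  assume "\<not> r \<le> 1"
  define d where "d = r - 1"
  have d: "d > 0" "r = 1 + d" using \<open>\<not> r \<le> 1\<close> by (auto simp: d_def)
  obtain n where n: "(1 + 2 * C) / d\<^sup>2 < 2 ^ n"
    using real_arch_pow[of 2] by auto
  have "(2 ^ n * d)\<^sup>2 \<le> (r ^ 2 ^ n)\<^sup>2"
    using Bernoulli_inequality[of d "2 ^ n"] d by (intro power_mono) auto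
  also have "\<dots> = r ^ 2 ^ Suc n" by (simp add: mult.commute flip: power_mult)
  also have "\<dots> \<le> 1 + C * 2 ^ Suc n" by (rule grow)
  also have "\<dots> \<le> 2 ^ n * (1 + 2 * C)" by (simp add: algebra_simps)
  finally have "2 ^ n * (2 ^ n * d\<^sup>2) \<le> 2 ^ n * (1 + 2 * C)"
    by (simp add: power2_eq_square algebra_simps)
  then have "2 ^ n * d\<^sup>2 \<le> 1 + 2 * C" by (rule mult_left_le_imp_le) simp
  moreover have "1 + 2 * C < 2 ^ n * d\<^sup>2" using n d by (simp add: pos_divide_less_eq)
  ultimately show False by simp
qed

section \<open>Square roots and positivity\<close>

text \<open>The element \<open>g = 1 - v\<close> is a square root of \<open>1 - u\<close> iff \<open>v = (u + v\<^sup>2)/2\<close>.  On the ball of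
  radius \<open>\<parallel>u\<parallel> < 1\<close> in the self-adjoint double commutant of \<open>u\<close> the right-hand side is a contraction
  with constant \<open>\<parallel>u\<parallel>\<close>.  Working inside the double
  commutant yields the commutation property that later products of roots rely on.\<close>

lemma sqrt_one_minus:
  fixes u :: "'a::unital_cstar_algebra"
  assumes u: "star u = u" "norm u < 1"
  obtains g where "star g = g" "g * g = 1 - u" "\<And>c. c * u = u * c \<Longrightarrow> c * g = g * c"
proof -
  define S where "S = {v. star v = v \<and> norm v \<le> norm u} \<inter> (\<Inter>c\<in>{c. c * u = u * c}. {v. c * v = v * c})"
  define F where "F v = (1/2) *\<^sub>R (u + v * v)" for v
  have cont: "continuous_on UNIV (star :: 'a \<Rightarrow> 'a)"
    by (rule bounded_linear.continuous_on[OF bounded_linear_star continuous_on_id])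
  have SD: "star v = v" "norm v \<le> norm u" "\<And>c. c * u = u * c \<Longrightarrow> c * v = v * c" if "v \<in> S" for v
    using that by (auto simp: S_def)
  have "closed S"
    unfolding S_def
    by (intro closed_Int closed_INT ballI closed_Collect_conj closed_Collect_eq closed_Collect_le
        continuous_intros cont)
  then have "complete S" by (simp add: complete_eq_closed)
  moreover have "0 \<in> S" by (simp add: S_def star_zero)
  moreover have "F ` S \<subseteq> S"
  proof (rule image_subsetI)
    fix v assume v: "v \<in> S"
    have "norm (F v) \<le> (norm u + norm v * norm v) / 2"
      using norm_triangle_ineq[of u "v * v"] norm_mult_ineq[of v v] by (simp add: F_def)
    also have "\<dots> \<le> (norm u + norm u * 1) / 2"
      using SD(2)[OF v] u by (intro divide_right_mono add_left_mono mult_mono) auto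
    finally have "norm (F v) \<le> norm u" by simp
    moreover have "c * F v = F v * c" if "c * u = u * c" for c
    proof -
      have "c * v = v * c" by (rule SD(3)[OF v that])
      then have "c * (v * v) = v * v * c" by (metis mult.assoc)
      then show ?thesis by (simp add: F_def that distrib_left distrib_right)
    qed
    moreover have "star (F v) = F v"
      by (simp add: F_def star_scaleR star_add star_mult SD(1)[OF v] u(1))
    ultimately show "F v \<in> S" by (auto simp: S_def)
  qed
  moreover have "dist (F v) (F w) \<le> norm u * dist v w" if "v \<in> S" "w \<in> S" for v w
  proof -
    \<comment> \<open>this splitting of \<open>v\<^sup>2 - w\<^sup>2\<close> avoids asking whether \<open>v\<close> and \<open>w\<close> commute\<close>
    have "F v - F w = (1/2) *\<^sub>R (v * (v - w) + (v - w) * w)"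
      by (simp add: F_def distrib_left left_diff_distrib right_diff_distrib flip: scaleR_diff_right)
    then have "norm (F v - F w) \<le> (norm v * norm (v - w) + norm (v - w) * norm w) / 2"
      using norm_triangle_ineq[of "v * (v - w)" "(v - w) * w"]
        norm_mult_ineq[of v "v - w"] norm_mult_ineq[of "v - w" w] by simp
    also have "\<dots> \<le> (norm u * norm (v - w) + norm (v - w) * norm u) / 2"
      using SD(2)[OF that(1)] SD(2)[OF that(2)]
      by (intro divide_right_mono add_mono mult_mono) auto
    finally show ?thesis by (simp add: dist_norm)
  qed
  ultimately obtain v where v: "v \<in> S" "F v = v"
    using Banach_fix[of S "norm u" F] u(2) by (metis empty_iff norm_ge_zero)
  have "v + v = u + v * v"
  proof -
    have "2 *\<^sub>R F v = u + v * v" by (simp add: F_def)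
    then show ?thesis using v(2) by (simp add: scaleR_2)
  qed
  then have sq: "(1 - v) * (1 - v) = 1 - u" by (simp add: algebra_simps)
  have "star (1 - v) = 1 - v" by (simp add: SD(1)[OF v(1)] star_diff star_one)
  moreover note sq
  moreover have "c * (1 - v) = (1 - v) * c" if "c * u = u * c" for c
    using SD(3)[OF v(1) that] by (simp add: right_diff_distrib left_diff_distrib)
  ultimately show thesis by (rule that)
qed

text \<open>Both sides are visible in \<open>w = g + i h\<close>: commutativity gives \<open>w\<^sup>* w = g\<^sup>2 + h\<^sup>2\<close>, and \<open>g\<close> is
  the real part of \<open>w\<close>.\<close>

lemma norm_sum_commuting_squares:
  fixes g h :: "'a::unital_cstar_algebra"
  assumes "star g = g" "star h = h" "g * h = h * g"
  shows "(norm g)\<^sup>2 \<le> norm (g * g + h * h)"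
proof -
  define w where "w = g + scaleC \<i> h"
  have sw: "star w = g - scaleC \<i> h"
    by (simp add: w_def star_add star_scaleC assms scaleC_minus_left)
  have "star w * w = g * g + h * h"
    unfolding sw by (simp add: w_def distrib_left left_diff_distrib scaleC_diff_right
        mult_scaleC_left mult_scaleC_right assms(3) scaleC_i_scaleC_i)
  then have n: "(norm w)\<^sup>2 = norm (g * g + h * h)" by (metis cstar_identity)
  have "g = (1/2) *\<^sub>R (w + star w)" unfolding sw by (simp add: w_def flip: scaleR_2)
  then have "norm g = norm (w + star w) / 2"
    by (metis norm_scaleR abs_of_nonneg mult_1_left times_divide_eq_left zero_le_divide_1_iff zero_le_numeral)
  then have "norm g \<le> (norm w + norm (star w)) / 2"
    using norm_triangle_ineq[of w "star w"] by simp
  then have "norm g \<le> norm w" by (simp add: norm_star)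
  then have "(norm g)\<^sup>2 \<le> (norm w)\<^sup>2" by (intro power_mono) auto
  then show ?thesis by (simp add: n)
qed

text \<open>In spectral terms, \<open>\<parallel>t - m\<parallel> \<le> t\<close> for a self-adjoint \<open>m\<close> says that the spectrum of \<open>m\<close> lies in
  \<open>[0, 2 t]\<close>; so this is positivity, in a form that mentions neither spectrum nor square
  root.\<close>

definition norm_positive :: "'a::unital_cstar_algebra \<Rightarrow> bool" where
  "norm_positive m \<longleftrightarrow> star m = m \<and> (\<exists>t\<ge>0. norm (t *\<^sub>R 1 - m) \<le> t)"

lemma norm_positive_large_radius:
  fixes m :: "'a::unital_cstar_algebra"
  assumes "norm_positive m"
  obtains t where "t \<ge> s" "t \<ge> 0" "norm (t *\<^sub>R 1 - m) \<le> t"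
proof -
  obtain t where t: "t \<ge> 0" "norm (t *\<^sub>R 1 - m) \<le> t" using assms by (auto simp: norm_positive_def)
  define r where "r = max s t"
  have "r *\<^sub>R 1 - m = (r - t) *\<^sub>R 1 + (t *\<^sub>R 1 - m)" by (simp add: scaleR_diff_left)
  then have "norm (r *\<^sub>R 1 - m) \<le> norm ((r - t) *\<^sub>R (1::'a)) + norm (t *\<^sub>R 1 - m)"
    by (metis norm_triangle_ineq)
  also have "\<dots> \<le> (r - t) + t" using t by (intro add_mono norm_scaleR_one_le) (auto simp: r_def)
  finally show thesis using t by (intro that[of r]) (auto simp: r_def)
qed

lemma norm_positive_add:
  fixes m k :: "'a::unital_cstar_algebra"
  assumes "norm_positive m" "norm_positive k"
  shows "norm_positive (m + k)"
proof -
  obtain t s where t: "t \<ge> 0" "norm (t *\<^sub>R 1 - m) \<le> t" "s \<ge> 0" "norm (s *\<^sub>R 1 - k) \<le> s"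
    using assms by (auto simp: norm_positive_def)
  have "(t + s) *\<^sub>R 1 - (m + k) = (t *\<^sub>R 1 - m) + (s *\<^sub>R 1 - k)" by (simp add: scaleR_add_left)
  then have "norm ((t + s) *\<^sub>R 1 - (m + k)) \<le> norm (t *\<^sub>R 1 - m) + norm (s *\<^sub>R 1 - k)"
    by (metis norm_triangle_ineq)
  then have "norm ((t + s) *\<^sub>R 1 - (m + k)) \<le> t + s" using t by linarith
  then show ?thesis using assms t unfolding norm_positive_def star_add
    by (metis add_nonneg_nonneg)
qed

lemma norm_positive_zero: "norm_positive 0"
  by (auto simp: norm_positive_def star_zero)

lemma norm_positive_sum:
  "(\<And>i. i \<in> I \<Longrightarrow> norm_positive (f i)) \<Longrightarrow> norm_positive (sum f I)"
  by (induction I rule: infinite_finite_induct) (auto intro: norm_positive_add norm_positive_zero)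

lemma norm_positive_scaleR:
  fixes m :: "'a::unital_cstar_algebra"
  assumes "norm_positive m" "r \<ge> 0"
  shows "norm_positive (r *\<^sub>R m)"
proof -
  obtain t where t: "t \<ge> 0" "norm (t *\<^sub>R 1 - m) \<le> t" using assms by (auto simp: norm_positive_def)
  have "norm ((r * t) *\<^sub>R 1 - r *\<^sub>R m) = r * norm (t *\<^sub>R 1 - m)"
    using assms(2) norm_scaleR[of r "t *\<^sub>R 1 - m"] by (simp add: scaleR_diff_right)
  also have "\<dots> \<le> r * t" using t assms by (intro mult_left_mono) auto
  finally show ?thesis using assms t unfolding norm_positive_def star_scaleR
    by (metis mult_nonneg_nonneg)
qed

text \<open>If \<open>\<parallel>h\<parallel> < 1\<close>, then \<open>g = \<surd>(1 - h\<^sup>2)\<close> exists and \<open>g\<^sup>2 + h\<^sup>2 = 1\<close>, so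
  \<open>norm_sum_commuting_squares\<close> gives \<open>\<parallel>1 - h\<^sup>2\<parallel> = \<parallel>g\<parallel>\<^sup>2 \<le> 1\<close>.  The general case follows by
  scaling.\<close>

lemma norm_positive_square:
  fixes h :: "'a::unital_cstar_algebra"
  assumes h: "star h = h"
  shows "norm_positive (h * h)"
proof -
  have small: "norm_positive (k * k)" if k: "star k = k" "norm k < 1" for k :: 'a
  proof -
    have "norm (k * k) = (norm k)\<^sup>2" using cstar_identity[of k] k by simp
    then have "norm (k * k) < 1" using k(2) by (simp add: abs_square_less_1)
    have "star (k * k) = k * k" by (simp add: star_mult k)
    obtain g where g: "star g = g" "g * g = 1 - k * k"
        "\<And>c. c * (k * k) = k * k * c \<Longrightarrow> c * g = g * c"
      by (rule sqrt_one_minus[OF \<open>star (k * k) = k * k\<close> \<open>norm (k * k) < 1\<close>]) blast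
    have "(norm g)\<^sup>2 \<le> norm (g * g + k * k)"
      using g(1) k(1) g(3)[of k] by (intro norm_sum_commuting_squares) (auto simp: mult.assoc)
    then have "(norm g)\<^sup>2 \<le> 1" using g(2) norm_one_le[where 'a='a] by simp
    moreover have "norm (g * g) = (norm g)\<^sup>2" using cstar_identity[of g] g(1) by simp
    ultimately have "norm (1 *\<^sub>R 1 - k * k) \<le> 1" using g(2) by simp
    then show ?thesis using \<open>star (k * k) = k * k\<close> unfolding norm_positive_def
      by (metis zero_le_one)
  qed
  define r where "r = norm h + 1"
  have r: "r > 0" by (simp add: r_def add_nonneg_pos)
  define k where "k = inverse r *\<^sub>R h"
  have "norm k < 1" using r by (simp add: k_def field_simps) (simp add: r_def)
  then have "norm_positive (r\<^sup>2 *\<^sub>R (k * k))"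
    using h by (intro norm_positive_scaleR small) (auto simp: k_def star_scaleR)
  moreover have "h = r *\<^sub>R k" using r by (simp add: k_def)
  then have "r\<^sup>2 *\<^sub>R (k * k) = h * h" by (simp add: power2_eq_square)
  ultimately show ?thesis by simp
qed

text \<open>The shift by \<open>e\<close> makes the norm of \<open>(t - m)/(t + e)\<close> strictly less than \<open>1\<close>, as
  \<open>sqrt_one_minus\<close> requires.\<close>

lemma norm_positive_sqrt:
  fixes m :: "'a::unital_cstar_algebra"
  assumes m: "norm_positive m" and e: "e > 0"
  obtains g where "star g = g" "g * g = m + e *\<^sub>R 1" "\<And>c. c * m = m * c \<Longrightarrow> c * g = g * c"
proof -
  obtain t where t: "t \<ge> 0" "norm (t *\<^sub>R 1 - m) \<le> t" "star m = m"
    using m by (auto simp: norm_positive_def)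
  define u where "u = inverse (t + e) *\<^sub>R (t *\<^sub>R 1 - m)"
  have "norm u \<le> inverse (t + e) * t"
    using t e by (simp add: u_def mult_left_mono)
  also have "\<dots> < 1" using t e by (simp add: field_simps)
  finally have "norm u < 1" .
  have "star u = u" by (simp add: u_def star_scaleR star_diff star_one t(3))
  obtain g where g: "star g = g" "g * g = 1 - u" "\<And>c. c * u = u * c \<Longrightarrow> c * g = g * c"
    by (rule sqrt_one_minus[OF \<open>star u = u\<close> \<open>norm u < 1\<close>]) blast
  define s where "s = sqrt (t + e)"
  have s: "s * s = t + e" using t e by (simp add: s_def)
  have "(t + e) *\<^sub>R u = t *\<^sub>R 1 - m" using t e by (simp add: u_def)
  then have "(s *\<^sub>R g) * (s *\<^sub>R g) = m + e *\<^sub>R 1"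
    by (simp add: s g(2) scaleR_diff_right) (simp add: scaleR_add_left)
  moreover have "star (s *\<^sub>R g) = s *\<^sub>R g" by (simp add: star_scaleR g(1))
  moreover have "c * (s *\<^sub>R g) = (s *\<^sub>R g) * c" if "c * m = m * c" for c
    using g(3)[of c] that by (simp add: u_def right_diff_distrib left_diff_distrib)
  ultimately show thesis by (intro that)
qed

text \<open>Up to \<open>e\<close>, both \<open>m\<close> and \<open>c - m\<close> are squares of commuting self-adjoint \<open>g\<close> and \<open>h\<close>; their
  sum is a scalar, which bounds \<open>\<parallel>g\<^sup>2\<parallel>\<close>.  The case \<open>c = 0\<close> says that the cone meets its negative only
  in \<open>0\<close>.\<close>

lemma norm_le_if_between:
  fixes m :: "'a::unital_cstar_algebra"
  assumes m: "norm_positive m" and cm: "norm_positive (c *\<^sub>R 1 - m)" and "c \<ge> 0"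
  shows "norm m \<le> c"
proof (rule field_le_epsilon)
  fix d :: real assume "d > 0"
  define e where "e = d / 3"
  have e: "e > 0" using \<open>d > 0\<close> by (simp add: e_def)
  obtain g where g: "star g = g" "g * g = m + e *\<^sub>R 1" "\<And>c. c * m = m * c \<Longrightarrow> c * g = g * c"
    by (rule norm_positive_sqrt[OF m e]) blast
  obtain h where h: "star h = h" "h * h = c *\<^sub>R 1 - m + e *\<^sub>R 1"
      "\<And>b. b * (c *\<^sub>R 1 - m) = (c *\<^sub>R 1 - m) * b \<Longrightarrow> b * h = h * b"
    by (rule norm_positive_sqrt[OF cm e]) blast
  have "m * g = g * m" by (rule g(3)) simp
  then have "g * h = h * g" by (intro h(3)) (simp add: right_diff_distrib left_diff_distrib)
  then have "(norm g)\<^sup>2 \<le> norm (g * g + h * h)"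
    by (intro norm_sum_commuting_squares g(1) h(1))
  also have "g * g + h * h = (c + e + e) *\<^sub>R 1"
    by (simp add: g(2) h(2) scaleR_add_left) (simp flip: scaleR_add_left)
  also have "norm \<dots> \<le> c + e + e"
    using \<open>c \<ge> 0\<close> e by (intro norm_scaleR_one_le) auto
  finally have "norm (g * g) \<le> c + 2 * e" using cstar_identity[of g] g(1) by simp
  moreover have "m = g * g - e *\<^sub>R 1" by (simp add: g(2))
  then have "norm m \<le> norm (g * g) + norm (e *\<^sub>R (1::'a))" by (metis norm_triangle_ineq4)
  ultimately have "norm m \<le> (c + 2 * e) + e"
    using norm_scaleR_one_le[OF less_imp_le[OF e], where 'a='a] by linarith
  then show "norm m \<le> c + d" by (simp add: e_def)
qed

section \<open>Positivity of \<open>x\<^sup>* x\<close>\<close>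

lemma star_mult_self_adjoint: "star (star x * x) = star x * (x::'a::cstar_algebra)"
  by (simp add: star_mult star_star)

text \<open>Write \<open>k = t + x\<^sup>* x\<close> and \<open>l = t + x x\<^sup>*\<close>.  From \<open>l x = x k\<close> one gets
  \<open>l^(n+1) = t l^n + x k^n x\<^sup>*\<close>, so the bound \<open>M\<close> for \<open>\<parallel>k\<parallel>\<close> gives a bound for \<open>\<parallel>l^n\<parallel>\<close> that
  exceeds \<open>M^n\<close> by a factor linear in \<open>n\<close> only.  For self-adjoint \<open>l\<close> this implies
  \<open>\<parallel>l\<parallel> \<le> M\<close>.  It is the norm form of the fact that \<open>x\<^sup>* x\<close> and \<open>x x\<^sup>*\<close> have the same spectrum
  apart from \<open>0\<close>.\<close>

lemma norm_shifted_swap: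
  fixes x :: "'a::unital_cstar_algebra"
  assumes M: "norm (t *\<^sub>R 1 + star x * x) \<le> M" and "0 \<le> t" "t \<le> M" "0 < M"
  shows "norm (t *\<^sub>R 1 + x * star x) \<le> M"
proof -
  define k where "k = t *\<^sub>R 1 + star x * x"
  define l where "l = t *\<^sub>R 1 + x * star x"
  define C where "C = (norm x)\<^sup>2"
  have "l * x = x * k" by (simp add: l_def k_def algebra_simps)
  then have lx: "l ^ n * x = x * k ^ n" for n
    by (induction n) (simp_all add: mult.assoc, simp flip: mult.assoc)
  have k: "norm (k ^ n) \<le> M ^ n" for n
  proof (induction n)
    case (Suc n)
    have "norm (k ^ Suc n) \<le> norm k * norm (k ^ n)" by (simp add: norm_mult_ineq)
    also have "\<dots> \<le> M * M ^ n" using Suc M by (intro mult_mono) (auto simp: k_def \<open>0 < M\<close> less_imp_le)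
    finally show ?case by simp
  qed (simp add: norm_one_le)
  \<comment> \<open>the factor \<open>M\<close> on the left avoids the exponent \<open>n - 1\<close> on the right\<close>
  have l: "M * norm (l ^ n) \<le> M ^ n * (M + n * C)" for n
  proof (induction n)
    case 0 show ?case using norm_one_le[where 'a='a] \<open>0 < M\<close> by simp
  next
    case (Suc n)
    have "l ^ Suc n = l ^ n * l" by (simp add: power_commutes)
    also have "\<dots> = t *\<^sub>R l ^ n + x * k ^ n * star x"
      using lx[of n] by (simp add: l_def distrib_left flip: mult.assoc)
    finally have "norm (l ^ Suc n) \<le> norm (t *\<^sub>R l ^ n) + norm (x * k ^ n * star x)"
      by (metis norm_triangle_ineq)
    also have "norm (x * k ^ n * star x) \<le> norm x * norm (k ^ n) * norm (star x)"
      by (meson mult_right_mono norm_ge_zero norm_mult_ineq order_trans)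
    also have "\<dots> \<le> norm x * M ^ n * norm (star x)"
      by (intro mult_right_mono mult_left_mono k) auto
    also have "\<dots> = C * M ^ n" by (simp add: C_def norm_star power2_eq_square)
    finally have "norm (l ^ Suc n) \<le> t * norm (l ^ n) + C * M ^ n" using \<open>0 \<le> t\<close> by simp
    also have "\<dots> \<le> M * norm (l ^ n) + C * M ^ n" using \<open>t \<le> M\<close> by (simp add: mult_right_mono)
    also have "\<dots> \<le> M ^ n * (M + n * C) + C * M ^ n" using Suc by simp
    finally have "norm (l ^ Suc n) \<le> M ^ n * (M + Suc n * C)" by (simp add: algebra_simps)
    then show ?case using \<open>0 < M\<close> by simp
  qed
  have sl: "star l = l" by (simp add: l_def star_add star_scaleR star_one star_mult star_star)
  have "(norm l / M) ^ 2 ^ n \<le> 1 + C / M * 2 ^ n" for n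
    using l[of "2 ^ n"] \<open>0 < M\<close> by (simp add: norm_power_self_adjoint[OF sl] power_divide field_simps)
  then have "norm l / M \<le> 1"
    using \<open>0 < M\<close> by (intro le_one_if_powers_grow_linearly[of _ "C / M"]) (auto simp: C_def)
  then show ?thesis using \<open>0 < M\<close> by (simp add: l_def)
qed

text \<open>With \<open>h\<close> and \<open>g\<close> twice the real part and, up to sign, twice the imaginary part of \<open>x\<close>, the
  element equals \<open>(h\<^sup>2 + g\<^sup>2)/2\<close>.\<close>

lemma norm_positive_star_mult_add_mult_star:
  fixes x :: "'a::unital_cstar_algebra"
  shows "norm_positive (star x * x + x * star x)"
proof -
  define h where "h = x + star x"
  define g where "g = scaleC \<i> (x - star x)"
  have "star h = h" by (simp add: h_def star_add star_star add.commute)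
  moreover have "star g = g"
    by (simp add: g_def star_scaleC star_diff star_star scaleC_minus_left scaleC_diff_right)
  moreover have "(1/2) *\<^sub>R (h * h + g * g) = star x * x + x * star x"
  proof -
    have "g * g = - ((x - star x) * (x - star x))"
      by (simp add: g_def mult_scaleC_left mult_scaleC_right scaleC_i_scaleC_i)
    then have "h * h + g * g = 2 *\<^sub>R (star x * x + x * star x)"
      by (simp add: h_def algebra_simps scaleR_2)
    then show ?thesis by simp
  qed
  moreover have "norm_positive ((1/2) *\<^sub>R (h * h + g * g))"
    by (intro norm_positive_scaleR norm_positive_add norm_positive_square calculation) simp
  ultimately show ?thesis by simp
qed

text \<open>Since \<open>b\<^sup>2\<close> is positive, \<open>x\<^sup>* x \<le> 1\<close>; hence \<open>x x\<^sup>* \<le> 1\<close> by \<open>norm_shifted_swap\<close>, and the positivity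
  of \<open>x\<^sup>* x + x x\<^sup>*\<close> gives \<open>x\<^sup>* x \<ge> -1\<close>, which is \<open>b\<^sup>2 \<le> 2\<close>.\<close>

lemma norm_square_le_two:
  fixes b x :: "'a::unital_cstar_algebra"
  assumes b: "star b = b" and x: "star x * x = 1 - b * b"
  shows "norm (b * b) \<le> 2"
proof (rule norm_le_if_between)
  show pos: "norm_positive (b * b)" by (rule norm_positive_square[OF b])
  obtain t where t: "t \<ge> 1" "norm (t *\<^sub>R 1 - b * b) \<le> t"
    by (rule norm_positive_large_radius[OF pos]) blast
  have "norm ((t - 1) *\<^sub>R 1 + star x * x) \<le> t" using t by (simp add: x scaleR_diff_left)
  then have "norm ((t - 1) *\<^sub>R 1 + x * star x) \<le> t"
    using t(1) by (intro norm_shifted_swap) auto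
  then have "norm (t *\<^sub>R 1 - (1 - x * star x)) \<le> t" by (simp add: scaleR_diff_left algebra_simps)
  then have "norm_positive (1 - x * star x)"
    using t(1) unfolding norm_positive_def
    by (auto simp: star_diff star_one star_mult star_star intro!: exI[of _ t])
  from norm_positive_add[OF this norm_positive_star_mult_add_mult_star[of x]]
  show "norm_positive (2 *\<^sub>R 1 - b * b)" by (simp add: x scaleR_2 algebra_simps)
qed simp

text \<open>As \<open>\<surd>(1 + a)\<close> commutes with \<open>x\<^sup>* x = 1 - a\<close>, the element \<open>z = x \<surd>(1 + a)\<close> has
  \<open>z\<^sup>* z = (1 + a) (1 - a)\<close>.\<close>

lemma one_minus_square_factors:
  fixes a x :: "'a::unital_cstar_algebra"
  assumes a: "norm_positive a" and x: "star x * x = 1 - a"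
  obtains z where "star z * z = 1 - a * a"
proof -
  have one: "0 < (1::real)" by simp
  obtain g where g: "star g = g" "g * g = a + 1 *\<^sub>R 1" "\<And>c. c * a = a * c \<Longrightarrow> c * g = g * c"
    by (rule norm_positive_sqrt[OF a one]) blast
  have "a * g = g * a" by (rule g(3)) simp
  then have "(1 - a) * g = g * (1 - a)" by (simp add: right_diff_distrib left_diff_distrib)
  moreover have "star (x * g) * (x * g) = g * ((star x * x) * g)"
    by (simp add: star_mult g(1) mult.assoc)
  ultimately have "star (x * g) * (x * g) = g * g * (1 - a)" by (simp add: x mult.assoc)
  also have "\<dots> = 1 - a * a" by (simp add: g(2) algebra_simps)
  finally show thesis by (rule that)
qed

text \<open>The powers \<open>a^(2^n)\<close> of \<open>a = 1 - x\<^sup>* x\<close> stay bounded by \<open>2\<close>: iterating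
  \<open>one_minus_square_factors\<close> writes each \<open>1 - a^(2^n)\<close> as \<open>z\<^sup>* z\<close>, and
  \<open>norm_square_le_two\<close> applies.\<close>

lemma norm_one_minus_star_mult_le:
  fixes x :: "'a::unital_cstar_algebra"
  assumes "norm x \<le> 1"
  shows "norm (1 - star x * x) \<le> 1"
proof (rule le_one_if_powers_grow_linearly[of _ 1])
  define a where "a = 1 - star x * x"
  have a: "star a = a" by (simp add: a_def star_diff star_one star_mult_self_adjoint)
  have sa: "star (a ^ n) = a ^ n" for n by (simp add: star_power a)
  have dbl: "a ^ 2 ^ Suc n = a ^ 2 ^ n * a ^ 2 ^ n" for n by (simp add: mult_2 power_add)
  have "norm (1 *\<^sub>R 1 - a) \<le> 1"
    using assms by (simp add: a_def cstar_identity abs_square_le_1)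
  then have pa: "norm_positive a" using a unfolding norm_positive_def by (metis zero_le_one)
  have pos: "norm_positive (a ^ 2 ^ n)" for n
    by (cases n) (use pa sa norm_positive_square dbl in auto)
  have ex: "\<exists>z. star z * z = 1 - a ^ 2 ^ n" for n
  proof (induction n)
    case 0 show ?case by (auto simp: a_def)
  next
    case (Suc n) then show ?case
      unfolding dbl using one_minus_square_factors[OF pos] by metis
  qed
  \<comment> \<open>\<open>n = 0\<close> is separate because \<open>a\<close> itself is not known to be a square\<close>
  show "norm (1 - star x * x) ^ 2 ^ n \<le> 1 + 1 * 2 ^ n" for n
  proof (cases n)
    case 0
    have "norm a \<le> norm (1::'a) + norm (star x * x)" unfolding a_def by (rule norm_triangle_ineq4)
    also have "\<dots> \<le> 1 + 1"
      using assms by (intro add_mono norm_one_le) (simp add: cstar_identity abs_square_le_1)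
    finally show ?thesis by (simp add: 0 a_def)
  next
    case (Suc m)
    obtain z where "star z * z = 1 - a ^ 2 ^ m * a ^ 2 ^ m" using ex[of n] Suc dbl by auto
    then have "norm (a ^ 2 ^ n) \<le> 2" unfolding Suc dbl by (rule norm_square_le_two[OF sa])
    then have "norm a ^ 2 ^ n \<le> 2" by (simp add: norm_power_self_adjoint[OF a])
    also have "\<dots> \<le> 1 + 1 * 2 ^ n" by simp
    finally show ?thesis by (simp add: a_def)
  qed
qed simp

theorem norm_positive_star_mult:
  fixes x :: "'a::unital_cstar_algebra"
  shows "norm_positive (star x * x)"
proof -
  define r where "r = norm x + 1"
  have r: "r > 0" by (simp add: r_def add_nonneg_pos)
  define y where "y = inverse r *\<^sub>R x"
  have "norm y \<le> 1" using r by (simp add: y_def field_simps) (simp add: r_def)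
  from norm_one_minus_star_mult_le[OF this] have "norm_positive (star y * y)"
    unfolding norm_positive_def by (auto simp: star_mult_self_adjoint intro!: exI[of _ 1])
  then have "norm_positive (r\<^sup>2 *\<^sub>R (star y * y))" by (intro norm_positive_scaleR) auto
  moreover have "x = r *\<^sub>R y" using r by (simp add: y_def)
  then have "r\<^sup>2 *\<^sub>R (star y * y) = star x * x" by (simp add: star_scaleR power2_eq_square)
  ultimately show ?thesis by simp
qed

text \<open>A vanishing sum makes each \<open>w\<^sub>k\<^sup>* w\<^sub>k\<close> both positive and, as minus the sum of the other terms,
  negative.\<close>

lemma sum_star_mult_eq_0D:
  fixes w :: "nat \<Rightarrow> 'a::unital_cstar_algebra"
  assumes "(\<Sum>k<n. star (w k) * w k) = 0" and "k < n"
  shows "w k = 0"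
proof -
  have "(\<Sum>i<n. star (w i) * w i) = star (w k) * w k + (\<Sum>i\<in>{..<n} - {k}. star (w i) * w i)"
    using \<open>k < n\<close> by (intro sum.remove) auto
  then have "- (star (w k) * w k) = (\<Sum>i\<in>{..<n} - {k}. star (w i) * w i)"
    using assms(1) by (intro minus_unique) simp
  then have "0 *\<^sub>R 1 - star (w k) * w k = (\<Sum>i\<in>{..<n} - {k}. star (w i) * w i)"
    by simp
  then have "norm_positive (0 *\<^sub>R 1 - star (w k) * w k)"
    by (simp only:) (intro norm_positive_sum norm_positive_star_mult)
  then have "norm (star (w k) * w k) \<le> 0"
    by (intro norm_le_if_between norm_positive_star_mult) auto
  then show ?thesis by (simp add: cstar_identity)
qed

section \<open>Completely positive maps\<close>

lemma star_mat_mult_index: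
  assumes "E \<in> carrier_mat n n" "i < n" "j < n"
  shows "(star_mat E * E) $$ (i, j) = (\<Sum>k<n. star (E $$ (k, i)) * E $$ (k, j))"
  using assms by (auto simp: star_mat_def scalar_prod_def atLeast0LessThan intro!: sum.cong)

text \<open>The Gram matrix \<open>(b\<^sub>i\<^sup>* b\<^sub>j)\<close> is \<open>B\<^sup>* B\<close> for the square matrix \<open>B\<close> whose first row is \<open>b\<close> and
  whose other rows vanish; the columns of \<open>C\<close> realise its image as a Gram matrix again.\<close>

lemma completely_positive_gram:
  fixes \<Phi> :: "'a::cstar_algebra \<Rightarrow> 'b::cstar_algebra" and b :: "nat \<Rightarrow> 'a"
  assumes cp: "completely_positive \<Phi>"
  obtains C where "\<And>i j. i < n \<Longrightarrow> j < n \<Longrightarrow>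
    \<Phi> (star (b i) * b j) = (\<Sum>k<n. star (C k i) * C k j)"
proof -
  define B where "B = mat n n (\<lambda>(i, j). if i = 0 then b j else 0)"
  have B: "B \<in> carrier_mat n n" by (simp add: B_def)
  then have "positive_mat n (star_mat B * B)" by (auto simp: positive_mat_def)
  then have "positive_mat n (map_mat \<Phi> (star_mat B * B))"
    using cp by (simp add: completely_positive_def)
  then obtain D where D: "D \<in> carrier_mat n n" "map_mat \<Phi> (star_mat B * B) = star_mat D * D"
    by (auto simp: positive_mat_def)
  show thesis
  proof (rule that[of "\<lambda>k i. D $$ (k, i)"])
    fix i j assume ij: "i < n" "j < n"
    have "(star_mat B * B) $$ (i, j) = (\<Sum>k<n. if k = 0 then star (b i) * b j else 0)"
      unfolding star_mat_mult_index[OF B ij] using ij by (intro sum.cong) (auto simp: B_def star_zero)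
    also have "\<dots> = star (b i) * b j" using ij by (simp add: sum.delta)
    finally have "map_mat \<Phi> (star_mat B * B) $$ (i, j) = \<Phi> (star (b i) * b j)"
      using ij B by (simp add: star_mat_def)
    then show "\<Phi> (star (b i) * b j) = (\<Sum>k<n. star (D $$ (k, i)) * D $$ (k, j))"
      using D star_mat_mult_index[OF D(1) ij] by simp
  qed
qed

context
  fixes \<Phi> :: "'a::unital_cstar_algebra \<Rightarrow> 'b::unital_cstar_algebra"
  assumes linear: "complex_linear \<Phi>" and cp: "completely_positive \<Phi>" and unital: "\<Phi> 1 = 1"
begin

text \<open>In the image of the Gram matrix of \<open>1\<close> and \<open>x\<close>, the two off-diagonal entries are
  \<open>\<Phi> x\<close> and \<open>\<Phi> (x\<^sup>*)\<close>, and every Gram matrix is self-adjoint.\<close>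

lemma cp_star: "\<Phi> (star x) = star (\<Phi> x)"
proof -
  obtain C :: "nat \<Rightarrow> nat \<Rightarrow> 'b" where C: "\<And>i j. i < 2 \<Longrightarrow> j < 2 \<Longrightarrow>
     \<Phi> (star (([1, x] ! i)) * ([1, x] ! j)) = (\<Sum>k<2. star (C k i) * C k j)"
    by (rule completely_positive_gram[OF cp, of 2 "\<lambda>i. [1, x] ! i"]) blast
  show ?thesis using C[of 0 1] C[of 1 0]
    by (simp add: star_one star_sum star_mult star_star)
qed

text \<open>The column \<open>w\<close> is the residual of the column of \<open>a\<close> after projection along the column of \<open>1\<close>,
  and \<open>v\<close> is the column of \<open>x\<^sup>*\<close>.  The first equation contains Schwarz's inequality; the second shows
  that \<open>w\<close> also controls the failure of multiplicativity at \<open>x a\<close>.\<close>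

lemma cp_schwarz_defect:
  obtains w :: "nat \<Rightarrow> 'b" and v
  where "\<Phi> (star a * a) - star (\<Phi> a) * \<Phi> a = (\<Sum>k<3. star (w k) * w k)"
    and "\<Phi> (x * a) - \<Phi> x * \<Phi> a = (\<Sum>k<3. star (v k) * w k)"
proof -
  let ?b = "\<lambda>i. [1, a, star x] ! i"
  obtain C :: "nat \<Rightarrow> nat \<Rightarrow> 'b" where C: "\<And>i j. i < 3 \<Longrightarrow> j < 3 \<Longrightarrow>
     \<Phi> (star (?b i) * ?b j) = (\<Sum>k<3. star (C k i) * C k j)"
    by (rule completely_positive_gram[OF cp, of 3 ?b]) blast
  define w where "w k = C k 1 - C k 0 * \<Phi> a" for k
  have pair: "(\<Sum>k<3. star (C k i) * w k) = \<Phi> (star (?b i) * a) - \<Phi> (star (?b i)) * \<Phi> a"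
    if "i < 3" for i
  proof -
    have "(\<Sum>k<3. star (C k i) * w k)
        = (\<Sum>k<3. star (C k i) * C k 1) - (\<Sum>k<3. star (C k i) * C k 0) * \<Phi> a"
      by (simp add: w_def algebra_simps sum_subtractf sum_distrib_right)
    then show ?thesis using C[of i 1] C[of i 0] that by simp
  qed
  have "(\<Sum>k<3. star (w k) * w k)
      = (\<Sum>k<3. star (C k 1) * w k) - star (\<Phi> a) * (\<Sum>k<3. star (C k 0) * w k)"
    by (simp add: w_def star_diff star_mult left_diff_distrib sum_subtractf sum_distrib_left mult.assoc)
  also have "\<dots> = \<Phi> (star a * a) - star (\<Phi> a) * \<Phi> a"
    using pair[of 0] pair[of 1] by (simp add: star_one unital cp_star)
  finally show thesis
    using pair[of 2] by (intro that[of w "\<lambda>k. C k 2"]) (auto simp: star_star)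
qed

lemma cp_mult_right:
  assumes "\<Phi> (star a * a) = star (\<Phi> a) * \<Phi> a"
  shows "\<Phi> (x * a) = \<Phi> x * \<Phi> a"
proof -
  obtain w v :: "nat \<Rightarrow> 'b" where w: "\<Phi> (star a * a) - star (\<Phi> a) * \<Phi> a = (\<Sum>k<3. star (w k) * w k)"
    and v: "\<Phi> (x * a) - \<Phi> x * \<Phi> a = (\<Sum>k<3. star (v k) * w k)"
    by (rule cp_schwarz_defect[of a x]) blast
  have "w k = 0" if "k < 3" for k
    using sum_star_mult_eq_0D[of w 3 k] w assms that by simp
  then show ?thesis using v by simp
qed

text \<open>For \<open>\<parallel>x\<parallel> < 1\<close> write \<open>1 - x\<^sup>* x = g\<^sup>2\<close>.  Then
  \<open>1 - \<Phi>(x)\<^sup>* \<Phi>(x) = \<Phi>(g\<^sup>2) + (\<Phi>(x\<^sup>* x) - \<Phi>(x)\<^sup>* \<Phi>(x))\<close> is positive by Schwarz's inequality, so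
  \<open>\<parallel>\<Phi> x\<parallel> \<le> 1\<close>.\<close>

lemma cp_bounded_linear: "bounded_linear \<Phi>"
proof -
  have add: "\<Phi> (x + y) = \<Phi> x + \<Phi> y" and scale: "\<Phi> (r *\<^sub>R x) = r *\<^sub>R \<Phi> x" for x y r
    using linear by (auto simp: complex_linear_def scaleR_scaleC)
  have pos: "norm_positive (\<Phi> (star y * y))" for y
  proof -
    obtain C :: "nat \<Rightarrow> nat \<Rightarrow> 'b" where "\<And>i j. i < 1 \<Longrightarrow> j < 1 \<Longrightarrow> \<Phi> (star y * y) = (\<Sum>k<1. star (C k i) * C k j)"
      by (rule completely_positive_gram[OF cp, of 1 "\<lambda>_. y"]) blast
    from this[of 0 0] show ?thesis by (simp add: norm_positive_star_mult)
  qed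
  have small: "norm (\<Phi> x) \<le> 1" if x: "norm x < 1" for x
  proof -
    have "norm (star x * x) < 1" using x by (simp add: cstar_identity abs_square_less_1)
    then obtain g where g: "star g = g" "g * g = 1 - star x * x"
      by (rule sqrt_one_minus[OF star_mult_self_adjoint]) blast
    obtain w :: "nat \<Rightarrow> 'b"
      where w: "\<Phi> (star x * x) - star (\<Phi> x) * \<Phi> x = (\<Sum>k<3. star (w k) * w k)"
      by (rule cp_schwarz_defect[of x]) blast
    have "\<Phi> (star g * g) + \<Phi> (star x * x) = 1"
      by (simp add: g unital flip: add)
    then have "1 *\<^sub>R 1 - star (\<Phi> x) * \<Phi> x = \<Phi> (star g * g) + (\<Sum>k<3. star (w k) * w k)"
      by (simp add: algebra_simps flip: w)
    then have "norm_positive (1 *\<^sub>R 1 - star (\<Phi> x) * \<Phi> x)"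
      by (simp only:) (intro norm_positive_add pos norm_positive_sum norm_positive_star_mult)
    then have "norm (star (\<Phi> x) * \<Phi> x) \<le> 1"
      by (intro norm_le_if_between norm_positive_star_mult) auto
    then show ?thesis by (simp add: cstar_identity abs_square_le_1)
  qed
  show ?thesis
  proof (rule bounded_linear_intro[where K = 2, OF add scale])
    fix x
    show "norm (\<Phi> x) \<le> norm x * 2"
    proof (cases "x = 0")
      case True then show ?thesis using scale[of 0 0] by simp
    next
      case False
      have "norm (\<Phi> (inverse (2 * norm x) *\<^sub>R x)) \<le> 1" using False by (intro small) simp
      then show ?thesis using False by (simp add: scale field_simps)
    qed
  qed
qed

end

text \<open>Closedness uses the boundedness of \<open>\<Phi>\<close>; invariance under the involution uses that \<open>\<Phi>\<close>
  preserves it, which exchanges the left and the right condition.\<close>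

lemma cstar_subalgebra_bimodule_elements:
  fixes \<Phi> :: "'a::unital_cstar_algebra \<Rightarrow> 'a"
  assumes linear: "complex_linear \<Phi>" and cp: "completely_positive \<Phi>" and unital: "\<Phi> 1 = 1"
  shows "cstar_subalgebra {b. \<forall>x. \<Phi> (b * x) = b * \<Phi> x \<and> \<Phi> (x * b) = \<Phi> x * b}" (is "cstar_subalgebra ?S")
proof -
  have add: "\<Phi> (x + y) = \<Phi> x + \<Phi> y" and scale: "\<Phi> (scaleC c x) = scaleC c (\<Phi> x)" for x y c
    using linear by (auto simp: complex_linear_def)
  note bl = cp_bounded_linear[OF assms]
  have zero: "\<Phi> 0 = 0" by (rule linear_0[OF bounded_linear.linear[OF bl]])
  have cont: "continuous_on UNIV (\<lambda>b. \<Phi> (f b))" if "continuous_on UNIV f" for f :: "'a \<Rightarrow> 'a"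
    using bounded_linear.continuous_on[OF bl that] .
  have "?S = (\<Inter>x. {b. \<Phi> (b * x) = b * \<Phi> x} \<inter> {b. \<Phi> (x * b) = \<Phi> x * b})" by auto
  also have "closed \<dots>"
    by (intro closed_INT closed_Int ballI closed_Collect_eq cont continuous_intros)
  finally have "closed ?S" .
  moreover have "star b \<in> ?S" if "b \<in> ?S" for b
  proof -
    have "\<Phi> (star b * x) = star b * \<Phi> x \<and> \<Phi> (x * star b) = \<Phi> x * star b" for x
    proof -
      have "star (\<Phi> (star x * b)) = star (\<Phi> (star x) * b)" "star (\<Phi> (b * star x)) = star (b * \<Phi> (star x))"
        using that by auto
      then show ?thesis
        by (simp add: star_mult star_star flip: cp_star[OF assms])
    qed
    then show ?thesis by simp
  qed
  moreover have "b * c \<in> ?S" if "b \<in> ?S" "c \<in> ?S" for b c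
    using that by (simp add: mult.assoc) (simp flip: mult.assoc)
  ultimately show ?thesis
    unfolding cstar_subalgebra_def
    by (auto simp: zero add scale algebra_simps mult_scaleC_left mult_scaleC_right)
qed

theorem theorem2p4:
  fixes \<Phi> :: "'a::unital_cstar_algebra \<Rightarrow> 'a" and a :: 'a
  assumes "complex_linear \<Phi>"
    and "completely_positive \<Phi>"
    and "\<Phi> 1 = 1"
  shows "({a, star a * a, a * star a} \<subseteq> fixed_points \<Phi>
            \<longleftrightarrow> a \<in> fixed_points \<Phi> \<inter> multiplicative_domain \<Phi>) \<and>
         (a \<in> fixed_points \<Phi> \<inter> multiplicative_domain \<Phi>
            \<longleftrightarrow> (\<forall>x. \<Phi> (a * x) = a * \<Phi> x \<and> \<Phi> (x * a) = \<Phi> x * a)) \<and>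
         (a \<in> fixed_points \<Phi> \<inter> multiplicative_domain \<Phi>
            \<longleftrightarrow> generated_cstar {1, a} \<subseteq> fixed_points \<Phi>)"
proof -
  note star = cp_star[OF assms]
  let ?i = "{a, star a * a, a * star a} \<subseteq> fixed_points \<Phi>"
  let ?ii = "a \<in> fixed_points \<Phi> \<inter> multiplicative_domain \<Phi>"
  let ?bimodule = "\<lambda>b. \<forall>x. \<Phi> (b * x) = b * \<Phi> x \<and> \<Phi> (x * b) = \<Phi> x * b"
  have i_ii: "?i \<longleftrightarrow> ?ii"
    by (auto simp: fixed_points_def multiplicative_domain_def star)
  have ii_bimodule: "?bimodule a" if ?ii
  proof -
    have a: "\<Phi> a = a" and l: "\<Phi> (star a * a) = star (\<Phi> a) * \<Phi> a"
      and r: "\<Phi> (a * star a) = \<Phi> a * \<Phi> (star a)"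
      using that by (auto simp: fixed_points_def multiplicative_domain_def)
    have "\<Phi> (star (star a) * star a) = star (\<Phi> (star a)) * \<Phi> (star a)"
      using r by (simp add: star star_star)
    then have "\<Phi> (star x * star a) = \<Phi> (star x) * \<Phi> (star a)" for x
      by (rule cp_mult_right[OF assms])
    then have "star (\<Phi> (a * x)) = star (a * \<Phi> x)" for x
      using star[of "a * x"] by (simp add: star_mult star a)
    then have "\<Phi> (a * x) = a * \<Phi> x" for x by (metis star_star)
    moreover have "\<Phi> (x * a) = \<Phi> x * a" for x
      using cp_mult_right[OF assms l] by (simp add: a)
    ultimately show ?thesis by simp
  qed
  have fixed: "b \<in> fixed_points \<Phi>" if "?bimodule b" for b
    using that[rule_format, of 1] assms(3) by (simp add: fixed_points_def)
  have bimodule_ii: ?ii if b: "?bimodule a"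
    using b fixed[OF b] unfolding fixed_points_def multiplicative_domain_def by (auto simp: star)
  have bimodule_iii: "generated_cstar {1, a} \<subseteq> fixed_points \<Phi>" if "?bimodule a"
  proof -
    have "generated_cstar {1, a} \<subseteq> {b. ?bimodule b}"
      unfolding generated_cstar_def
      using that by (intro hull_minimal cstar_subalgebra_bimodule_elements assms) auto
    then show ?thesis using fixed by blast
  qed
  have "{a, star a * a, a * star a} \<subseteq> generated_cstar {1, a}"
    by (auto simp: generated_cstar_def hull_def cstar_subalgebra_def)
  then have "?ii" if "generated_cstar {1, a} \<subseteq> fixed_points \<Phi>"
    using that i_ii by blast
  then show ?thesis using i_ii ii_bimodule bimodule_ii bimodule_iii by blast
qed

end
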